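(* For any integer $n\geq 2$ the group of units $H(\mathbb{I})$ of the semigroup $\mathcal{PO}_{\infty}(\mathbb{N}^n_{\leqslant})$ is isomorphic to the group $\mathcal{S}_n$ of permutations of an $n$-element set. Moreover, every element of $H(\mathbb{I})$ permutes the coordinates of elements of $\mathbb{N}^n$, and only these permutations are elements of $H(\mathbb{I})$; that is, $H(\mathbb{I})$ consists exactly of the maps $\mathbb{N}^n\to\mathbb{N}^n$, $(x_1,\ldots,x_n)\mapsto(x_{\pi(1)},\ldots,x_{\pi(n)})$, where $\pi$ is a permutation of $\{1,\ldots,n\}$.
   Context: $\mathbb{N}$ is the set of positive integers, and $\mathbb{N}^n_{\leqslant}$ is the set $\mathbb{N}^n$ with the product order: $(i_1,\ldots,i_n)\leqslant(j_1,\ldots,j_n)$ iff $i_k\le j_k$ for all $k$. A partial map $\alpha$ of a poset is monotone if $x\leqslant y$ implies $(x)\alpha\leqslant(y)\alpha$ for all $x,y\in\operatorname{dom}\alpha$. Maps are written on the right, and partial maps are composed by $(x)(\alpha\beta)=((x)\alpha)\beta$ with $\operatorname{dom}(\alpha\beta)=\{y\in\operatorname{dom}\alpha: (y)\alpha\in\operatorname{dom}\beta\}$. $\mathcal{PO}_{\infty}(\mathbb{N}^n_{\leqslant})$ is the semigroup, under this composition, of all injective monotone partial selfmaps $\alpha$ of $\mathbb{N}^n_{\leqslant}$ such that $\mathbb{N}^n\setminus\operatorname{dom}\alpha$ and $\mathbb{N}^n\setminus\operatorname{ran}\alpha$ are finite. Its identity is the identity map $\mathbb{I}$ of $\mathbb{N}^n$,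 and $H(\mathbb{I})$ is its group of units. *)

theory Defs
  imports "HOL-Library.FuncSet" "HOL-Algebra.Sym_Groups"
begin

text \<open>Points of $\mathbb{N}^n$, where $\mathbb{N}$ is the set of positive integers: extensional functions
  on the index set \<open>{1..n}\<close>, so that two points are equal iff their coordinates agree.\<close>

definition pos_tuples :: "nat \<Rightarrow> (nat \<Rightarrow> nat) set" where
  "pos_tuples n = {1..n} \<rightarrow>\<^sub>E {1..}"

definition prod_le :: "nat \<Rightarrow> (nat \<Rightarrow> nat) \<Rightarrow> (nat \<Rightarrow> nat) \<Rightarrow> bool" where
  "prod_le n x y \<longleftrightarrow> (\<forall>k\<in>{1..n}. x k \<le> y k)"

definition partial_monotone :: "nat \<Rightarrow> ((nat \<Rightarrow> nat) \<rightharpoonup> (nat \<Rightarrow> nat)) \<Rightarrow> bool" where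
  "partial_monotone n \<alpha> \<longleftrightarrow>
     (\<forall>x\<in>dom \<alpha>. \<forall>y\<in>dom \<alpha>. prod_le n x y \<longrightarrow> prod_le n (the (\<alpha> x)) (the (\<alpha> y)))"

definition PO_inf_set :: "nat \<Rightarrow> ((nat \<Rightarrow> nat) \<rightharpoonup> (nat \<Rightarrow> nat)) set" where
  "PO_inf_set n = {\<alpha>. dom \<alpha> \<subseteq> pos_tuples n \<and> ran \<alpha> \<subseteq> pos_tuples n \<and>
     inj_on \<alpha> (dom \<alpha>) \<and> partial_monotone n \<alpha> \<and>
     finite (pos_tuples n - dom \<alpha>) \<and> finite (pos_tuples n - ran \<alpha>)}"

text \<open>Maps act on the right, so the product \<open>\<alpha>\<beta>\<close> applies \<open>\<alpha>\<close> first.\<close>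

definition PO_inf :: "nat \<Rightarrow> ((nat \<Rightarrow> nat) \<rightharpoonup> (nat \<Rightarrow> nat)) monoid" where
  "PO_inf n = \<lparr>carrier = PO_inf_set n, mult = (\<lambda>\<alpha> \<beta>. \<beta> \<circ>\<^sub>m \<alpha>), one = Some |` pos_tuples n\<rparr>"

definition coord_perm :: "nat \<Rightarrow> (nat \<Rightarrow> nat) \<Rightarrow> ((nat \<Rightarrow> nat) \<rightharpoonup> (nat \<Rightarrow> nat))" where
  "coord_perm n \<pi> = (\<lambda>x. Some (\<lambda>i\<in>{1..n}. x (\<pi> i))) |` pos_tuples n"

lemma PO_inf_set_mult_closed:
  assumes "\<alpha> \<in> PO_inf_set n" "\<beta> \<in> PO_inf_set n"
  shows "\<beta> \<circ>\<^sub>m \<alpha> \<in> PO_inf_set n"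
proof -
  let ?N = "pos_tuples n" and ?\<gamma> = "\<beta> \<circ>\<^sub>m \<alpha>"
  have a: "dom \<alpha> \<subseteq> ?N" "ran \<alpha> \<subseteq> ?N" "inj_on \<alpha> (dom \<alpha>)" "partial_monotone n \<alpha>"
      "finite (?N - dom \<alpha>)" "finite (?N - ran \<alpha>)"
    and b: "dom \<beta> \<subseteq> ?N" "ran \<beta> \<subseteq> ?N" "inj_on \<beta> (dom \<beta>)" "partial_monotone n \<beta>"
      "finite (?N - dom \<beta>)" "finite (?N - ran \<beta>)"
    using assms by (auto simp: PO_inf_set_def)
  have ia: "x = y" if "\<alpha> x = Some z" "\<alpha> y = Some z" for x y z
    using a(3) that by (auto simp: inj_on_def dom_def)
  have ib: "x = y" if "\<beta> x = Some z" "\<beta> y = Some z" for x y z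
    using b(3) that by (auto simp: inj_on_def dom_def)
  have "dom ?\<gamma> \<subseteq> ?N"
    using a(1) by (auto simp: map_comp_Some_iff dom_def)
  moreover have "ran ?\<gamma> \<subseteq> ?N"
    using b(2) by (auto simp: map_comp_Some_iff ran_def)
  moreover have "inj_on ?\<gamma> (dom ?\<gamma>)"
    using ia ib by (auto simp: inj_on_def dom_def map_comp_Some_iff)
  moreover have "partial_monotone n ?\<gamma>"
    using a(4) b(4) by (fastforce simp: partial_monotone_def dom_def map_comp_Some_iff)
  moreover have "finite (?N - dom ?\<gamma>)"
  proof (rule finite_subset)
    show "?N - dom ?\<gamma> \<subseteq> (?N - dom \<alpha>) \<union> (\<alpha> -` Some ` (?N - dom \<beta>) \<inter> dom \<alpha>)"
      using a(2) by (fastforce simp: ran_def dom_def map_comp_def split: option.splits)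
    show "finite ((?N - dom \<alpha>) \<union> (\<alpha> -` Some ` (?N - dom \<beta>) \<inter> dom \<alpha>))"
      using a(3,5) b(5) by (auto intro!: finite_vimage_IntI)
  qed
  moreover have "finite (?N - ran ?\<gamma>)"
  proof (rule finite_subset)
    show "?N - ran ?\<gamma> \<subseteq> (?N - ran \<beta>) \<union> (the \<circ> \<beta>) ` (?N - ran \<alpha>)"
    proof
      fix z assume z: "z \<in> ?N - ran ?\<gamma>"
      show "z \<in> (?N - ran \<beta>) \<union> (the \<circ> \<beta>) ` (?N - ran \<alpha>)"
      proof (cases "z \<in> ran \<beta>")
        case True
        then obtain y where y: "\<beta> y = Some z" by (auto simp: ran_def)
        have "y \<notin> ran \<alpha>"
        proof
          assume "y \<in> ran \<alpha>"
          then obtain x where "\<alpha> x = Some y" by (auto simp: ran_def)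
          with y have "?\<gamma> x = Some z" by simp
          with z show False by (auto simp: ran_def)
        qed
        with y b(1) show ?thesis by (force simp: dom_def)
      qed (use z in simp)
    qed
  qed (use a(6) b(6) in simp)
  ultimately show ?thesis by (simp add: PO_inf_set_def)
qed

lemma PO_inf_monoid: "monoid (PO_inf n)"
proof (rule monoidI)
  have "dom (Some |` pos_tuples n) = pos_tuples n" "ran (Some |` pos_tuples n) = pos_tuples n"
    by (auto simp: ran_def dom_def restrict_map_def split: if_splits)
  then show "\<one>\<^bsub>PO_inf n\<^esub> \<in> carrier (PO_inf n)"
    by (auto simp: PO_inf_def PO_inf_set_def partial_monotone_def inj_on_def)
next
  fix \<alpha> \<beta> assume "\<alpha> \<in> carrier (PO_inf n)" "\<beta> \<in> carrier (PO_inf n)"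
  then show "\<alpha> \<otimes>\<^bsub>PO_inf n\<^esub> \<beta> \<in> carrier (PO_inf n)"
    by (simp add: PO_inf_def PO_inf_set_mult_closed)
next
  fix \<alpha> \<beta> \<gamma>
  show "\<alpha> \<otimes>\<^bsub>PO_inf n\<^esub> \<beta> \<otimes>\<^bsub>PO_inf n\<^esub> \<gamma> = \<alpha> \<otimes>\<^bsub>PO_inf n\<^esub> (\<beta> \<otimes>\<^bsub>PO_inf n\<^esub> \<gamma>)"
    by (auto simp: PO_inf_def map_comp_def fun_eq_iff split: option.splits)
next
  fix \<alpha> assume "\<alpha> \<in> carrier (PO_inf n)"
  then have d: "dom \<alpha> \<subseteq> pos_tuples n" and r: "ran \<alpha> \<subseteq> pos_tuples n"
    by (auto simp: PO_inf_def PO_inf_set_def)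
  show "\<one>\<^bsub>PO_inf n\<^esub> \<otimes>\<^bsub>PO_inf n\<^esub> \<alpha> = \<alpha>"
  proof -
    have "\<alpha> x = None" if "x \<notin> pos_tuples n" for x
      using d that by blast
    then show ?thesis
      by (auto simp: PO_inf_def map_comp_def restrict_map_def fun_eq_iff)
  qed
  show "\<alpha> \<otimes>\<^bsub>PO_inf n\<^esub> \<one>\<^bsub>PO_inf n\<^esub> = \<alpha>"
    using r by (auto simp: PO_inf_def map_comp_def restrict_map_def fun_eq_iff ran_def split: option.splits)
qed

end

theory Submission
  imports Defs
begin

text \<open>
  A unit of \<open>PO_inf n\<close> is the same thing as an order automorphism of the whole of
  $\mathbb{N}^n$: it and its inverse are total and monotone.  Such an automorphism $f$ must
  preserve everything that can be expressed by the order alone.  The minimal elements above the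
  bottom element are the points having one coordinate equal to 2 and the others equal to 1, so
  $f$ permutes these atoms; this defines a map $\pi$ of the coordinates.  The points that
  lie above only the $i$-th atom form the $i$-th axis, hence $f$ carries the $i$-th axis into the
  $\pi(i)$-th one.  As $f$ is strictly increasing along that axis, the point at height $m$ goes to
  one of height at least $m$.  Every point dominates its projections to the axes, which gives
  $x_i \le f(x)_{\pi(i)}$.  The same inequality for $f^{-1}$, whose map of atoms is $\pi^{-1}$,
  turns this into an equality, so $f$ permutes coordinates.

  Conversely, $\pi \mapsto (x \mapsto x \circ \pi)$ is an injective homomorphism from the
  symmetric group into the units.  Pulling tuples back along permutations reverses the order of
  composition, and so does composing maps from left to right; the two reversals cancel.
\<close>

section \<open>Points on the coordinate axes\<close>

definition axis_point :: "nat \<Rightarrow> nat \<Rightarrow> nat \<Rightarrow> nat \<Rightarrow> nat" where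
  "axis_point n i m = (\<lambda>j\<in>{1..n}. if j = i then m else 1)"

lemma pos_tuples_ge_1: "x \<in> pos_tuples n \<Longrightarrow> i \<in> {1..n} \<Longrightarrow> 1 \<le> x i"
  by (fastforce simp: pos_tuples_def PiE_def Pi_def)

lemma pos_tuples_eqI:
  "x \<in> pos_tuples n \<Longrightarrow> y \<in> pos_tuples n \<Longrightarrow> (\<And>i. i \<in> {1..n} \<Longrightarrow> x i = y i) \<Longrightarrow> x = y"
  unfolding pos_tuples_def by (rule PiE_ext)

lemma axis_point_in_pos_tuples: "1 \<le> m \<Longrightarrow> axis_point n i m \<in> pos_tuples n"
  by (auto simp: axis_point_def pos_tuples_def)

lemma axis_point_same [simp]: "i \<in> {1..n} \<Longrightarrow> axis_point n i m i = m"
  by (simp add: axis_point_def)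

lemma axis_point_other [simp]: "j \<in> {1..n} \<Longrightarrow> j \<noteq> i \<Longrightarrow> axis_point n i m j = 1"
  by (simp add: axis_point_def)

lemma atom_neq_bottom: "k \<in> {1..n} \<Longrightarrow> axis_point n k 2 \<noteq> axis_point n i 1"
  by (auto simp: axis_point_def fun_eq_iff intro!: exI[of _ k])

lemma axis_point_le_iff:
  assumes "x \<in> pos_tuples n" "i \<in> {1..n}"
  shows "prod_le n (axis_point n i m) x \<longleftrightarrow> m \<le> x i"
  using assms pos_tuples_ge_1[OF assms(1)] by (auto simp: prod_le_def axis_point_def)

lemma prod_le_antisym:
  "x \<in> pos_tuples n \<Longrightarrow> y \<in> pos_tuples n \<Longrightarrow> prod_le n x y \<Longrightarrow> prod_le n y x \<Longrightarrow> x = y"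
  by (rule pos_tuples_eqI) (auto simp: prod_le_def intro: antisym)

text \<open>Height 2 on an axis is an atom of the order: only the bottom element, which is the point of
  height 1 on every axis, lies strictly below it.\<close>

lemma le_atom_cases:
  assumes x: "x \<in> pos_tuples n" and i: "i \<in> {1..n}" and le: "prod_le n x (axis_point n i 2)"
  shows "x = axis_point n i 1 \<or> x = axis_point n i 2"
proof -
  have "x i \<le> 2"
    using le i unfolding prod_le_def by (metis axis_point_same)
  moreover have "1 \<le> x i"
    using x i by (rule pos_tuples_ge_1)
  ultimately have "x i = 1 \<or> x i = 2" by linarith
  moreover have "x j = 1" if "j \<in> {1..n}" "j \<noteq> i" for j
  proof -
    have "x j \<le> 1"
      using le that unfolding prod_le_def by (metis axis_point_other)
    then show ?thesis using pos_tuples_ge_1[OF x that(1)] by linarith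
  qed
  ultimately have "\<exists>m\<in>{1,2}. \<forall>j\<in>{1..n}. x j = axis_point n i m j"
    using i by (metis axis_point_other axis_point_same insertCI)
  then obtain m where "m \<in> {1, 2}" "\<And>j. j \<in> {1..n} \<Longrightarrow> x j = axis_point n i m j"
    by blast
  then have "x = axis_point n i m"
    by (intro pos_tuples_eqI[OF x] axis_point_in_pos_tuples) auto
  then show ?thesis
    using \<open>m \<in> {1, 2}\<close> by blast
qed

section \<open>Order automorphisms\<close>

text \<open>Naming the inverse makes the situation symmetric, so that each fact about \<open>f\<close> is available
  for \<open>g\<close> as well.\<close>

locale pos_tuples_automorphism =
  fixes n :: nat and f g :: "(nat \<Rightarrow> nat) \<Rightarrow> (nat \<Rightarrow> nat)"
  assumes f_in: "x \<in> pos_tuples n \<Longrightarrow> f x \<in> pos_tuples n"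
    and g_in: "x \<in> pos_tuples n \<Longrightarrow> g x \<in> pos_tuples n"
    and g_f: "x \<in> pos_tuples n \<Longrightarrow> g (f x) = x"
    and f_g: "x \<in> pos_tuples n \<Longrightarrow> f (g x) = x"
    and f_mono: "x \<in> pos_tuples n \<Longrightarrow> y \<in> pos_tuples n \<Longrightarrow> prod_le n x y \<Longrightarrow> prod_le n (f x) (f y)"
    and g_mono: "x \<in> pos_tuples n \<Longrightarrow> y \<in> pos_tuples n \<Longrightarrow> prod_le n x y \<Longrightarrow> prod_le n (g x) (g y)"
begin

lemma inverse_automorphism: "pos_tuples_automorphism n g f"
  by unfold_locales (simp_all add: f_in g_in g_f f_g f_mono g_mono)

lemma f_bottom:
  assumes i: "i \<in> {1..n}"
  shows "f (axis_point n i 1) = axis_point n i 1"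
proof -
  let ?b = "axis_point n i 1"
  have b: "?b \<in> pos_tuples n" by (simp add: axis_point_in_pos_tuples)
  have least: "prod_le n ?b x" if "x \<in> pos_tuples n" for x
    using that i pos_tuples_ge_1 axis_point_le_iff by blast
  have "prod_le n (f ?b) (f (g ?b))"
    using b g_in f_mono least by blast
  then show ?thesis
    using b f_in f_g least prod_le_antisym by metis
qed

text \<open>The image of an atom lies above some atom, whose preimage lies below the given atom and is
  not the bottom element; by minimality it is the given atom.\<close>

lemma f_atom:
  assumes i: "i \<in> {1..n}"
  shows "\<exists>j\<in>{1..n}. f (axis_point n i 2) = axis_point n j 2"
proof -
  let ?a = "\<lambda>i. axis_point n i 2" and ?b = "\<lambda>i. axis_point n i 1"
  have a: "?a k \<in> pos_tuples n" and b: "?b k \<in> pos_tuples n" for k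
    by (simp_all add: axis_point_in_pos_tuples)
  have "f (?a i) \<noteq> ?b i"
  proof
    assume "f (?a i) = ?b i"
    then have "?a i = ?b i" using f_bottom[OF i] g_f[OF a] g_f[OF b] by metis
    then show False using atom_neq_bottom[OF i] by blast
  qed
  then obtain j where j: "j \<in> {1..n}" and "f (?a i) j \<noteq> ?b i j"
    using pos_tuples_eqI[OF f_in[OF a] b] by blast
  then have "2 \<le> f (?a i) j"
    using pos_tuples_ge_1[OF f_in[OF a] j, of i] i by (cases "j = i") auto
  then have "prod_le n (?a j) (f (?a i))"
    using axis_point_le_iff[OF f_in[OF a] j] by blast
  then have "prod_le n (g (?a j)) (?a i)"
    using g_mono[OF a f_in[OF a]] g_f[OF a] by metis
  then have "g (?a j) = ?b i \<or> g (?a j) = ?a i"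
    using le_atom_cases g_in[OF a] i by blast
  moreover have "g (?a j) \<noteq> ?b i"
  proof
    assume "g (?a j) = ?b i"
    then have "?a j = ?b i" using f_bottom[OF i] f_g[OF a] by metis
    then show False using atom_neq_bottom[OF j] by blast
  qed
  ultimately show ?thesis using f_g[OF a] j by metis
qed

text \<open>No atom except the \<open>i\<close>-th lies below a point of the \<open>i\<close>-th axis, so no atom except the \<open>j\<close>-th
  lies below its image, which is thus on the \<open>j\<close>-th axis.  Two such images on the \<open>j\<close>-th axis are determined by their \<open>j\<close>-th coordinates, which
  therefore increase strictly.\<close>

lemma f_axis_point_ge:
  assumes i: "i \<in> {1..n}" and j: "j \<in> {1..n}"
    and atom: "f (axis_point n i 2) = axis_point n j 2"
    and m: "1 \<le> m"
  shows "m \<le> f (axis_point n i m) j"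
proof -
  let ?p = "axis_point n i"
  have p: "?p k \<in> pos_tuples n" if "1 \<le> k" for k
    using that by (rule axis_point_in_pos_tuples)
  have off: "f (?p k) l = 1" if k: "1 \<le> k" and l: "l \<in> {1..n}" "l \<noteq> j" for k l
  proof (rule ccontr)
    assume "f (?p k) l \<noteq> 1"
    then have "2 \<le> f (?p k) l"
      using pos_tuples_ge_1[OF f_in[OF p[OF k]] l(1)] by linarith
    then have "prod_le n (axis_point n l 2) (f (?p k))"
      using axis_point_le_iff[OF f_in[OF p[OF k]] l(1)] by blast
    then have le: "prod_le n (g (axis_point n l 2)) (?p k)"
      using g_mono[OF _ f_in[OF p[OF k]]] g_f[OF p[OF k]] axis_point_in_pos_tuples[of 2 n l]
      by simp
    interpret inv: pos_tuples_automorphism n g f by (rule inverse_automorphism)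
    obtain h where h: "h \<in> {1..n}" "g (axis_point n l 2) = axis_point n h 2"
      using inv.f_atom l by blast
    then have "2 \<le> ?p k h"
      using le axis_point_le_iff[OF p[OF k] h(1)] by simp
    then have "h = i" using h by (cases "h = i") auto
    then have "axis_point n l 2 = axis_point n j 2"
      using h atom f_g[of "axis_point n l 2"] by (simp add: axis_point_in_pos_tuples)
    then have "axis_point n l 2 l = axis_point n j 2 l" by simp
    then show False using l by simp
  qed
  show ?thesis
    using m
  proof (induction m rule: dec_induct)
    case base
    show ?case using pos_tuples_ge_1[OF f_in[OF p] j] by simp
  next
    case (step k)
    have k: "1 \<le> k" "1 \<le> Suc k" using step by auto
    have "?p k i \<noteq> ?p (Suc k) i" using i by simp
    then have "f (?p k) \<noteq> f (?p (Suc k))" using g_f[OF p[OF k(1)]] g_f[OF p[OF k(2)]] by metis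
    then have "f (?p k) j \<noteq> f (?p (Suc k)) j"
      using pos_tuples_eqI[OF f_in[OF p[OF k(1)]] f_in[OF p[OF k(2)]]] off k by metis
    moreover have "prod_le n (?p k) (?p (Suc k))"
      using axis_point_le_iff[OF p[OF k(2)] i] i by simp
    then have "f (?p k) j \<le> f (?p (Suc k)) j"
      using f_mono[OF p[OF k(1)] p[OF k(2)]] j by (simp add: prod_le_def)
    ultimately show ?case using step by simp
  qed
qed

lemma coord_le_coord_image:
  assumes i: "i \<in> {1..n}" and j: "j \<in> {1..n}"
    and atom: "f (axis_point n i 2) = axis_point n j 2"
    and x: "x \<in> pos_tuples n"
  shows "x i \<le> f x j"
proof -
  have p: "axis_point n i (x i) \<in> pos_tuples n"
    using x i by (intro axis_point_in_pos_tuples pos_tuples_ge_1)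
  have "prod_le n (axis_point n i (x i)) x"
    using x i axis_point_le_iff by blast
  then have "f (axis_point n i (x i)) j \<le> f x j"
    using f_mono[OF p x] j by (simp add: prod_le_def)
  moreover have "x i \<le> f (axis_point n i (x i)) j"
    using f_axis_point_ge[OF i j atom] pos_tuples_ge_1[OF x i] by simp
  ultimately show ?thesis by linarith
qed

theorem permutes_coordinates:
  "\<exists>\<pi>. \<pi> permutes {1..n} \<and> (\<forall>x\<in>pos_tuples n. f x = (\<lambda>i\<in>{1..n}. x (\<pi> i)))"
proof -
  interpret inv: pos_tuples_automorphism n g f by (rule inverse_automorphism)
  have atom: "axis_point n k 2 \<in> pos_tuples n" for k by (simp add: axis_point_in_pos_tuples)
  have atom_inj: "k = l" if "k \<in> {1..n}" "axis_point n k 2 = axis_point n l 2" for k l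
    using fun_cong[OF that(2), of k] that(1) by (cases "k = l") auto
  \<comment> \<open>Reading off coordinates of \<open>f x\<close> requires the map of atoms belonging to \<open>g\<close>.\<close>
  obtain \<rho> where \<rho>: "\<And>i. i \<in> {1..n} \<Longrightarrow> \<rho> i \<in> {1..n}"
      "\<And>i. i \<in> {1..n} \<Longrightarrow> g (axis_point n i 2) = axis_point n (\<rho> i) 2"
    using inv.f_atom by metis
  have f_\<rho>: "f (axis_point n (\<rho> i) 2) = axis_point n i 2" if "i \<in> {1..n}" for i
    using \<rho>[OF that] f_g atom by metis
  define \<pi> where "\<pi> i = (if i \<in> {1..n} then \<rho> i else i)" for i
  have "inj_on \<rho> {1..n}"
    using f_\<rho> atom_inj by (metis inj_onI)
  then have "bij_betw \<rho> {1..n} {1..n}"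
    using \<rho>(1) by (simp add: bij_betw_def endo_inj_surj image_subset_iff)
  then have "bij_betw \<pi> {1..n} {1..n}"
    by (subst bij_betw_cong[of _ \<pi> \<rho>]) (auto simp: \<pi>_def)
  then have "\<pi> permutes {1..n}"
    by (rule bij_imp_permutes) (auto simp: \<pi>_def)
  moreover have "f x = (\<lambda>i\<in>{1..n}. x (\<pi> i))" if x: "x \<in> pos_tuples n" for x
  proof (rule extensionalityI)
    show "f x \<in> extensional {1..n}"
      using f_in[OF x] by (simp add: pos_tuples_def PiE_def)
    fix i assume i: "i \<in> {1..n}"
    have "x (\<rho> i) \<le> f x i"
      using coord_le_coord_image \<rho>(1) f_\<rho> i x by blast
    moreover have "f x i \<le> g (f x) (\<rho> i)"
      using inv.coord_le_coord_image \<rho> i f_in[OF x] by blast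
    ultimately show "f x i = (\<lambda>i\<in>{1..n}. x (\<pi> i)) i"
      using i g_f[OF x] by (simp add: \<pi>_def)
  qed simp
  ultimately show ?thesis by blast
qed

end

section \<open>Units and coordinate permutations\<close>

text \<open>A unit and its inverse are defined everywhere, since their two products are the total
  identity map.\<close>

lemma unit_is_coord_perm:
  assumes "\<alpha> \<in> Units (PO_inf n)"
  shows "\<exists>\<pi>. \<pi> permutes {1..n} \<and> \<alpha> = coord_perm n \<pi>"
proof -
  let ?N = "pos_tuples n"
  obtain \<beta> where \<alpha>: "\<alpha> \<in> PO_inf_set n" and \<beta>: "\<beta> \<in> PO_inf_set n"
    and ba: "\<beta> \<circ>\<^sub>m \<alpha> = Some |` ?N" and ab: "\<alpha> \<circ>\<^sub>m \<beta> = Some |` ?N"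
    using assms by (auto simp: Units_def PO_inf_def)
  have a: "\<exists>y\<in>?N. \<alpha> x = Some y \<and> \<beta> y = Some x" if "x \<in> ?N" for x
    using fun_cong[OF ba, of x] that \<alpha>
    by (auto simp: map_comp_Some_iff PO_inf_set_def intro: ranI)
  have b: "\<exists>y\<in>?N. \<beta> x = Some y \<and> \<alpha> y = Some x" if "x \<in> ?N" for x
    using fun_cong[OF ab, of x] that \<beta>
    by (auto simp: map_comp_Some_iff PO_inf_set_def intro: ranI)
  have dom: "dom \<alpha> = ?N" "dom \<beta> = ?N"
    using a b \<alpha> \<beta> by (fastforce simp: PO_inf_set_def)+
  have mono_a: "partial_monotone n \<alpha>" and mono_b: "partial_monotone n \<beta>"
    using \<alpha> \<beta> by (simp_all add: PO_inf_set_def)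
  interpret pos_tuples_automorphism n "\<lambda>x. the (\<alpha> x)" "\<lambda>x. the (\<beta> x)"
  proof
    fix x assume "x \<in> ?N"
    then show "the (\<alpha> x) \<in> ?N" "the (\<beta> x) \<in> ?N" "the (\<beta> (the (\<alpha> x))) = x"
        "the (\<alpha> (the (\<beta> x))) = x"
      using a[of x] b[of x] by auto
    fix y assume "y \<in> ?N" "prod_le n x y"
    then show "prod_le n (the (\<alpha> x)) (the (\<alpha> y))" "prod_le n (the (\<beta> x)) (the (\<beta> y))"
      using mono_a mono_b \<open>x \<in> ?N\<close> dom by (simp_all add: partial_monotone_def)
  qed
  obtain \<pi> where \<pi>: "\<pi> permutes {1..n}" "\<And>x. x \<in> ?N \<Longrightarrow> the (\<alpha> x) = (\<lambda>i\<in>{1..n}. x (\<pi> i))"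
    using permutes_coordinates by blast
  have "\<alpha> x = coord_perm n \<pi> x" for x
  proof (cases "x \<in> ?N")
    case True
    then show ?thesis using a[OF True] \<pi>(2)[OF True] by (auto simp: coord_perm_def)
  next
    case False
    then have "\<alpha> x = None" using dom(1) by blast
    then show ?thesis using False by (simp add: coord_perm_def)
  qed
  then show ?thesis using \<pi>(1) by blast
qed

lemma permuted_in_pos_tuples:
  assumes "\<pi> permutes {1..n}" "x \<in> pos_tuples n"
  shows "(\<lambda>i\<in>{1..n}. x (\<pi> i)) \<in> pos_tuples n"
  using assms pos_tuples_ge_1[OF assms(2)] permutes_in_image[OF assms(1)]
  unfolding pos_tuples_def by (intro PiE_I) auto

lemma coord_perm_comp:
  assumes "\<pi> permutes {1..n}" "\<sigma> permutes {1..n}"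
  shows "coord_perm n \<sigma> \<circ>\<^sub>m coord_perm n \<pi> = coord_perm n (\<pi> \<circ> \<sigma>)"
proof
  fix x
  show "(coord_perm n \<sigma> \<circ>\<^sub>m coord_perm n \<pi>) x = coord_perm n (\<pi> \<circ> \<sigma>) x"
    using permuted_in_pos_tuples[OF assms(1), of x] permutes_in_image[OF assms(2)]
    by (cases "x \<in> pos_tuples n") (auto simp: coord_perm_def map_comp_def restrict_def fun_eq_iff)
qed

lemma coord_perm_id: "coord_perm n id = Some |` pos_tuples n"
  by (auto simp: coord_perm_def restrict_map_def fun_eq_iff pos_tuples_def
      simp del: restrict_apply dest: PiE_restrict)

lemma coord_perm_in_PO_inf_set:
  assumes \<pi>: "\<pi> permutes {1..n}"
  shows "coord_perm n \<pi> \<in> PO_inf_set n"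
proof -
  let ?N = "pos_tuples n" and ?c = "coord_perm n"
  have inv: "inv' \<pi> permutes {1..n}" using \<pi> by (rule permutes_inv)
  have cancel: "?c (inv' \<pi>) \<circ>\<^sub>m ?c \<pi> = Some |` ?N" "?c \<pi> \<circ>\<^sub>m ?c (inv' \<pi>) = Some |` ?N"
    using coord_perm_comp[OF \<pi> inv] coord_perm_comp[OF inv \<pi>] coord_perm_id
      permutes_inv_o[OF \<pi>] by simp_all
  have dom: "dom (?c \<sigma>) = ?N" for \<sigma>
    by (auto simp: coord_perm_def restrict_map_def dom_def)
  have ran: "ran (?c \<sigma>) \<subseteq> ?N" if "\<sigma> permutes {1..n}" for \<sigma>
    using permuted_in_pos_tuples[OF that]
    by (auto simp: coord_perm_def restrict_map_def ran_def split: if_splits)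
  have "?N \<subseteq> ran (?c \<pi>)"
  proof
    fix x assume "x \<in> ?N"
    then have "(?c \<pi> \<circ>\<^sub>m ?c (inv' \<pi>)) x = Some x" using cancel(2) by simp
    then show "x \<in> ran (?c \<pi>)" by (auto simp: map_comp_Some_iff intro: ranI)
  qed
  moreover have "inj_on (?c \<pi>) ?N"
  proof
    fix x y assume "x \<in> ?N" "y \<in> ?N" "?c \<pi> x = ?c \<pi> y"
    then have "(?c (inv' \<pi>) \<circ>\<^sub>m ?c \<pi>) x = (?c (inv' \<pi>) \<circ>\<^sub>m ?c \<pi>) y"
      by (simp add: map_comp_def)
    then show "x = y" using \<open>x \<in> ?N\<close> \<open>y \<in> ?N\<close> cancel(1) by simp
  qed
  moreover have "partial_monotone n (?c \<pi>)"
    using permutes_in_image[OF \<pi>]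
    by (auto simp: partial_monotone_def dom coord_perm_def prod_le_def)
  ultimately show ?thesis
    using dom[of \<pi>] ran[OF \<pi>] by (simp add: PO_inf_set_def Diff_eq_empty_iff[THEN iffD2])
qed

lemma coord_perm_in_Units:
  assumes \<pi>: "\<pi> permutes {1..n}"
  shows "coord_perm n \<pi> \<in> Units (PO_inf n)"
proof -
  have inv: "inv' \<pi> permutes {1..n}" using \<pi> by (rule permutes_inv)
  show ?thesis
    unfolding Units_def PO_inf_def
    using coord_perm_in_PO_inf_set[OF \<pi>] coord_perm_in_PO_inf_set[OF inv]
      coord_perm_comp[OF \<pi> inv] coord_perm_comp[OF inv \<pi>] coord_perm_id permutes_inv_o[OF \<pi>]
    by auto
qed

corollary Units_PO_inf: "Units (PO_inf n) = {coord_perm n \<pi> | \<pi>. \<pi> permutes {1..n}}"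
  using unit_is_coord_perm coord_perm_in_Units by blast

section \<open>The isomorphism with the symmetric group\<close>

text \<open>The tuple $(1, 2, \ldots, n)$ has pairwise different coordinates, so its image under a
  coordinate permutation determines the permutation.\<close>

lemma inj_on_coord_perm: "inj_on (coord_perm n) {\<pi>. \<pi> permutes {1..n}}"
proof (rule inj_onI, unfold mem_Collect_eq)
  fix \<pi> \<sigma> assume \<pi>: "\<pi> permutes {1..n}" and \<sigma>: "\<sigma> permutes {1..n}"
    and eq: "coord_perm n \<pi> = coord_perm n \<sigma>"
  let ?x = "\<lambda>i\<in>{1..n}. i"
  have "?x \<in> pos_tuples n" by (auto simp: pos_tuples_def)
  then have tuple: "(\<lambda>i\<in>{1..n}. ?x (\<pi> i)) = (\<lambda>i\<in>{1..n}. ?x (\<sigma> i))"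
    using fun_cong[OF eq, of ?x] by (simp add: coord_perm_def)
  show "\<pi> = \<sigma>"
  proof
    fix i
    show "\<pi> i = \<sigma> i"
    proof (cases "i \<in> {1..n}")
      case True
      then have "\<pi> i \<in> {1..n}" "\<sigma> i \<in> {1..n}"
        by (simp_all only: permutes_in_image[OF \<pi>] permutes_in_image[OF \<sigma>])
      then show ?thesis using fun_cong[OF tuple, of i] True by simp
    next
      case False
      then show ?thesis using \<pi> \<sigma> by (metis permutes_not_in)
    qed
  qed
qed

lemma coord_perm_iso: "coord_perm n \<in> iso (sym_group n) (units_of (PO_inf n))"
proof (rule isoI)
  show "coord_perm n \<in> hom (sym_group n) (units_of (PO_inf n))"
    using coord_perm_in_Units coord_perm_comp
    by (auto simp: hom_def sym_group_def units_of_def PO_inf_def)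
  show "bij_betw (coord_perm n) (carrier (sym_group n)) (carrier (units_of (PO_inf n)))"
    using inj_on_coord_perm
    by (auto simp: bij_betw_def sym_group_def units_of_def Units_PO_inf)
qed

theorem theorem2p1:
  fixes n :: nat
  assumes "n \<ge> 2"
  shows "units_of (PO_inf n) \<cong> sym_group n \<and>
         carrier (units_of (PO_inf n)) = {coord_perm n \<pi> | \<pi>. \<pi> permutes {1..n}}"
proof
  have "sym_group n \<cong> units_of (PO_inf n)"
    using coord_perm_iso by (rule is_isoI)
  then show "units_of (PO_inf n) \<cong> sym_group n"
    by (rule group.iso_sym[OF sym_group_is_group])
  show "carrier (units_of (PO_inf n)) = {coord_perm n \<pi> | \<pi>. \<pi> permutes {1..n}}"
    by (simp add: units_of_def Units_PO_inf)
qed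

end
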